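(* Let $G$ and $H$ be connected graphs, each of order at least $2$, with $\mu_{\rm it}(G)\ge 1$ and $\mu_{\rm it}(H)\ge 1$. Then $$\max\{\mu_{\rm it}(H)\mu_{\rm t}(G),\ \mu_{\rm it}(G)\mu_{\rm t}(H)\}\le \mu_{\rm t}(G\,\square\,H)\le \min\{\mu_{\rm t}(G)\,n(H),\ \mu_{\rm t}(H)\,n(G)\}.$$
   Context: All graphs are finite, simple and connected; $n(G)$ is the order of $G$. The Cartesian product $G\,\square\,H$ has vertex set $V(G)\times V(H)$, with $(g,h)$ adjacent to $(g',h')$ iff either $gg'\in E(G)$ and $h=h'$, or $g=g'$ and $hh'\in E(H)$. For $X\subseteq V(G)$, two vertices $x,y$ are $X$-visible if there is a shortest $x,y$-path $P$ with $V(P)\cap X\subseteq\{x,y\}$; $X$ is a total mutual-visibility set if every pair of vertices of $G$ is $X$-visible. $\mu_{\rm t}(G)$ is the largest cardinality of a total mutual-visibility set of $G$, and $\mu_{\rm it}(G)$ (independent total mutual-visibility number) is the largest cardinality of a total mutual-visibility set of $G$ that is an independent set. *)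

theory Defs
  imports "Graph_Theory.Graph_Theory"
begin

(* A finite simple graph is a pair_graph: finite vertex set, symmetric irreflexive arc set, so an
   edge gg' is the two arcs (g,g') and (g',g). *)

definition cartesian_product ::
    "'a pair_pre_digraph \<Rightarrow> 'b pair_pre_digraph \<Rightarrow> ('a \<times> 'b) pair_pre_digraph" (infixr "\<box>" 75) where
  "G \<box> H = \<lparr> pverts = pverts G \<times> pverts H,
     parcs = {((g, h), (g', h')).
       (g, h) \<in> pverts G \<times> pverts H \<and> (g', h') \<in> pverts G \<times> pverts H \<and>
       ((g, g') \<in> parcs G \<and> h = h' \<or> g = g' \<and> (h, h') \<in> parcs H)} \<rparr>"

(* Paths are lists of arcs; the empty list is the one-vertex path from x to x. *)
definition shortest_path :: "'a pair_pre_digraph \<Rightarrow> 'a \<Rightarrow> ('a \<times> 'a) awalk \<Rightarrow> 'a \<Rightarrow> bool" where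
  "shortest_path G x p y \<longleftrightarrow>
     pre_digraph.apath (with_proj G) x p y \<and>
     (\<forall>q. pre_digraph.apath (with_proj G) x q y \<longrightarrow> length p \<le> length q)"

definition visible :: "'a pair_pre_digraph \<Rightarrow> 'a set \<Rightarrow> 'a \<Rightarrow> 'a \<Rightarrow> bool" where
  "visible G X x y \<longleftrightarrow> (\<exists>p. shortest_path G x p y \<and> set (pawalk_verts x p) \<inter> X \<subseteq> {x, y})"

definition total_mutual_visibility_set :: "'a pair_pre_digraph \<Rightarrow> 'a set \<Rightarrow> bool" where
  "total_mutual_visibility_set G X \<longleftrightarrow>
     X \<subseteq> pverts G \<and> (\<forall>x \<in> pverts G. \<forall>y \<in> pverts G. visible G X x y)"

definition independent_set :: "'a pair_pre_digraph \<Rightarrow> 'a set \<Rightarrow> bool" where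
  "independent_set G X \<longleftrightarrow> X \<subseteq> pverts G \<and> (\<forall>x \<in> X. \<forall>y \<in> X. (x, y) \<notin> parcs G)"

(* For a finite connected graph both maxima range over finite sets containing 0; see the lemmas
   below. *)
definition mu_t :: "'a pair_pre_digraph \<Rightarrow> nat" where
  "mu_t G = Max {card X | X. total_mutual_visibility_set G X}"

definition mu_it :: "'a pair_pre_digraph \<Rightarrow> nat" where
  "mu_it G = Max {card X | X. total_mutual_visibility_set G X \<and> independent_set G X}"

lemma pair_graph_cartesian_product:
  assumes "pair_graph G" "pair_graph H"
  shows "pair_graph (G \<box> H)"
proof -
  interpret G: pair_graph G by fact
  interpret H: pair_graph H by fact
  have "parcs (G \<box> H) \<subseteq> (pverts G \<times> pverts H) \<times> (pverts G \<times> pverts H)"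
    by (auto simp: cartesian_product_def)
  then have fin: "finite (parcs (G \<box> H))"
    by (rule finite_subset) (simp add: G.pair_finite_verts H.pair_finite_verts)
  show ?thesis
  proof
    show "symmetric (with_proj (G \<box> H))"
      unfolding symmetric_def
      by (rule symI) (auto simp: cartesian_product_def dest: G.arcs_symmetric H.arcs_symmetric)
  qed (use fin in \<open>auto simp: cartesian_product_def G.pair_finite_verts H.pair_finite_verts
         dest: G.no_loops' H.no_loops'\<close>)
qed

lemma finite_total_mutual_visibility_sets:
  assumes "finite (pverts G)"
  shows "finite {X. total_mutual_visibility_set G X}"
  by (rule finite_subset[of _ "Pow (pverts G)"])
     (use assms in \<open>auto simp: total_mutual_visibility_set_def\<close>)

lemma total_mutual_visibility_set_empty:
  assumes "pair_graph G" "connected (with_proj G)"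
  shows "total_mutual_visibility_set G {}"
proof -
  interpret G: pair_graph G by fact
  have "\<exists>p. shortest_path G x p y" if "x \<in> pverts G" "y \<in> pverts G" for x y
  proof -
    have "x \<rightarrow>\<^sup>*\<^bsub>with_proj G\<^esub> y"
      using G.symmetric_connected_imp_strongly_connected[OF G.sym_arcs assms(2)] that
      by (simp add: strongly_connected_def)
    then have "\<exists>p. G.apath x p y"
      using G.reachable_apath by blast
    then obtain p where "G.apath x p y" "\<And>q. G.apath x q y \<Longrightarrow> length p \<le> length q"
      using exists_least_iff[of "\<lambda>n. \<exists>p. G.apath x p y \<and> length p = n"]
      by (metis linorder_not_less)
    then show ?thesis
      unfolding shortest_path_def by blast
  qed
  then show ?thesis
    by (simp add: total_mutual_visibility_set_def visible_def)
qed

lemma independent_set_empty: "independent_set G {}"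
  by (simp add: independent_set_def)

end

(* Lower bound: if S is a total mutual-visibility set of G and T an independent one of H, then
   S \<times> T is one of G \<box> H.  To connect (g, h) and (g', h') with h \<noteq> h', take suitable shortest
   paths P in G and Q in H; independence of T forces Q to have a vertex k outside T, and one
   follows Q up to k, then all of P inside the T-free layer over k, then the rest of Q.
   Upper bound: a shortest path between two vertices of one layer stays in that layer, so the
   fibres of a total mutual-visibility set of G \<box> H are such sets in the factors. *)

theory Submission
  imports Defs
begin

section \<open>Walks, their images under homomorphisms, and shortest paths\<close>

abbreviation pwalk :: "'a pair_pre_digraph \<Rightarrow> 'a \<Rightarrow> ('a \<times> 'a) awalk \<Rightarrow> 'a \<Rightarrow> bool" where
  "pwalk G \<equiv> pre_digraph.awalk (with_proj G)"

text \<open>Needed for the two layer embeddings and for the coordinate swap. Since walks may repeat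
  vertices, no injectivity of \<open>f\<close> enters.\<close>

lemma pwalk_map:
  assumes "pwalk K x p y" and "f ` pverts K \<subseteq> pverts L"
    and "\<And>a b. (a, b) \<in> parcs K \<Longrightarrow> (f a, f b) \<in> parcs L"
  shows "pwalk L (f x) (map (map_prod f f) p) (f y)"
proof -
  have "pcas x p y \<Longrightarrow> pcas (f x) (map (map_prod f f) p) (f y)"
    by (induction p arbitrary: x) auto
  then show ?thesis
    using assms by (auto simp: pre_digraph.awalk_def cas_with_proj_eq)
qed

lemma pawalk_verts_map:
  "pawalk_verts (f x) (map (map_prod f f) p) = map f (pawalk_verts x p)"
  by (induction p arbitrary: x) auto

lemma pwalk_ends_in_verts:
  assumes "pwalk G x p y"
  shows "x \<in> set (pawalk_verts x p)" "y \<in> set (pawalk_verts x p)"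
proof -
  have "pcas x p y"
    using assms by (simp add: pre_digraph.awalk_def cas_with_proj_eq)
  then show "x \<in> set (pawalk_verts x p)" "y \<in> set (pawalk_verts x p)"
    by (induction p arbitrary: x) auto
qed

text \<open>Cutting a closed piece out of a walk with a repeated vertex shortens it, so minimising
  over walks and over paths is the same. Walks can be projected, lifted and concatenated without
  checking distinctness.\<close>

lemma shortest_path_iff:
  assumes "pair_wf_digraph G"
  shows "shortest_path G x p y \<longleftrightarrow>
    pwalk G x p y \<and> (\<forall>q. pwalk G x q y \<longrightarrow> length p \<le> length q)" (is "_ \<longleftrightarrow> ?walk x p y")
proof -
  interpret G: pair_wf_digraph G by fact
  have shorten: "\<exists>q'. G.awalk x q' y \<and> length q' < length q"
    if walk: "G.awalk x q y" and rep: "\<not> distinct (pawalk_verts x q)" for q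
  proof -
    obtain r s t w where "q = r @ s @ t" "s \<noteq> []" "G.awalk x r w" "G.awalk w t y"
      using G.awalk_not_distinct_decomp[OF walk] rep by auto
    then show ?thesis
      by (intro exI[of _ "r @ t"]) auto
  qed
  have apath: "\<exists>q'. G.apath x q' y \<and> length q' \<le> length q" if "G.awalk x q y" for q
    using that
  \<comment> \<open>One cut may leave further repetitions, hence the induction on the
    length.\<close>
  proof (induction "length q" arbitrary: q rule: less_induct)
    case less
    then show ?case
      using shorten[OF less.prems] by (cases "distinct (pawalk_verts x q)") (force simp: G.apath_def)+
  qed
  show ?thesis
  proof
    assume sp: "shortest_path G x p y"
    have "length p \<le> length q" if "G.awalk x q y" for q
    proof -
      obtain q' where "G.apath x q' y" "length q' \<le> length q"
        using apath \<open>G.awalk x q y\<close> by blast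
      then show ?thesis
        using sp by (force simp: shortest_path_def)
    qed
    then show "?walk x p y"
      using sp by (simp add: shortest_path_def G.apath_def)
  next
    assume w: "?walk x p y"
    then have "distinct (pawalk_verts x p)"
      using shorten by (meson linorder_not_less)
    then show "shortest_path G x p y"
      using w by (simp add: shortest_path_def G.apath_def)
  qed
qed

lemma total_mutual_visibility_set_shortest_path:
  assumes "total_mutual_visibility_set G X" "x \<in> pverts G" "y \<in> pverts G"
  obtains p where "shortest_path G x p y" "set (pawalk_verts x p) \<inter> X \<subseteq> {x, y}"
  using assms unfolding total_mutual_visibility_set_def visible_def by blast

section \<open>Walks in the Cartesian product\<close>

lemma pverts_cartesian_product [simp]: "pverts (G \<box> H) = pverts G \<times> pverts H"
  by (simp add: cartesian_product_def)

lemma parcs_cartesian_product_iff: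
  "((g, h), (g', h')) \<in> parcs (G \<box> H) \<longleftrightarrow>
     (g, h) \<in> pverts G \<times> pverts H \<and> (g', h') \<in> pverts G \<times> pverts H \<and>
     ((g, g') \<in> parcs G \<and> h = h' \<or> g = g' \<and> (h, h') \<in> parcs H)"
  by (simp add: cartesian_product_def)

text \<open>Each arc of the product changes exactly one coordinate; sorting the arcs by that
  coordinate gives \<open>q\<close> and \<open>r\<close>. The length equation shows that distances
  add up. The two inclusions together recover the vertices of \<open>p\<close> from those of
  \<open>q\<close> once \<open>r\<close> is empty.\<close>

lemma pwalk_product_project:
  assumes "pair_wf_digraph G" "pair_wf_digraph H"
    and "pwalk (G \<box> H) (g, h) p (g', h')"
  obtains q r where "pwalk G g q g'" "pwalk H h r h'" "length p = length q + length r"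
    and "set (pawalk_verts (g, h) p) \<subseteq> set (pawalk_verts g q) \<times> set (pawalk_verts h r)"
    and "set (pawalk_verts g q) \<subseteq> fst ` set (pawalk_verts (g, h) p)"
proof -
  interpret G: pair_wf_digraph G by fact
  interpret H: pair_wf_digraph H by fact
  have "\<exists>q r. G.awalk g q g' \<and> H.awalk h r h' \<and> length p = length q + length r \<and>
      set (pawalk_verts (g, h) p) \<subseteq> set (pawalk_verts g q) \<times> set (pawalk_verts h r) \<and>
      set (pawalk_verts g q) \<subseteq> fst ` set (pawalk_verts (g, h) p)"
    using assms(3)
  proof (induction p arbitrary: g h)
    case Nil
    then show ?case
      by (intro exI[of _ "[]"]) (auto simp: pre_digraph.awalk_def cas_with_proj_eq)
  next
    case (Cons e p)
    obtain a b where e: "e = ((g, h), (a, b))" "e \<in> parcs (G \<box> H)"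
      using Cons.prems by (cases e) (auto simp: pre_digraph.awalk_def cas_with_proj_eq)
    have "pwalk (G \<box> H) (a, b) p (g', h')"
      using Cons.prems e by (auto simp: pre_digraph.awalk_def cas_with_proj_eq parcs_cartesian_product_iff)
    then obtain q r where IH: "G.awalk a q g'" "H.awalk b r h'" "length p = length q + length r"
      "set (pawalk_verts (a, b) p) \<subseteq> set (pawalk_verts a q) \<times> set (pawalk_verts b r)"
      "set (pawalk_verts a q) \<subseteq> fst ` set (pawalk_verts (a, b) p)"
      using Cons.IH by blast
    have "a \<in> set (pawalk_verts a q)" "b \<in> set (pawalk_verts b r)"
      using G.hd_in_awalk_verts(1)[OF IH(1)] H.hd_in_awalk_verts(1)[OF IH(2)] by auto
    moreover have "(g, a) \<in> parcs G \<and> h = b \<or> g = a \<and> (h, b) \<in> parcs H"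
      using e by (simp add: parcs_cartesian_product_iff)
    ultimately show ?case
    proof (elim disjE conjE)
      assume "a \<in> set (pawalk_verts a q)" "b \<in> set (pawalk_verts b r)" "(g, a) \<in> parcs G" "h = b"
      then show ?thesis
        using IH e by (intro exI[of _ "(g, a) # q"] exI[of _ r]) (auto simp: G.awalk_Cons_iff)
    next
      assume "a \<in> set (pawalk_verts a q)" "b \<in> set (pawalk_verts b r)" "g = a" "(h, b) \<in> parcs H"
      then show ?thesis
        using IH e by (intro exI[of _ q] exI[of _ "(h, b) # r"]) (auto simp: H.awalk_Cons_iff)
    qed
  qed
  then show ?thesis
    using that by blast
qed

lemma pwalk_layer_left:
  assumes "pair_wf_digraph G" "pwalk G g p g'" "h \<in> pverts H"
  shows "pwalk (G \<box> H) (g, h) (map (map_prod (\<lambda>a. (a, h)) (\<lambda>a. (a, h))) p) (g', h)"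
proof -
  interpret G: pair_wf_digraph G by fact
  show ?thesis
    by (rule pwalk_map[OF assms(2)])
       (use assms(3) in \<open>auto simp: parcs_cartesian_product_iff G.wellformed'\<close>)
qed

lemma pwalk_layer_right:
  assumes "pair_wf_digraph H" "pwalk H h p h'" "g \<in> pverts G"
  shows "pwalk (G \<box> H) (g, h) (map (map_prod (Pair g) (Pair g)) p) (g, h')"
proof -
  interpret H: pair_wf_digraph H by fact
  show ?thesis
    by (rule pwalk_map[OF assms(2)])
       (use assms(3) in \<open>auto simp: parcs_cartesian_product_iff H.wellformed'\<close>)
qed

section \<open>Total mutual-visibility sets of the product and of its factors\<close>

lemma pair_wf_digraph_cartesian_product:
  assumes "pair_wf_digraph G" "pair_wf_digraph H"
  shows "pair_wf_digraph (G \<box> H)"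
  by standard (auto simp: cartesian_product_def)

text \<open>A path that leaves the layer over \<open>h\<close> spends arcs in the direction of
  \<open>H\<close>; its projection to \<open>G\<close>, put back into the layer, would be
  shorter.\<close>

lemma total_mutual_visibility_set_fibre:
  assumes wf: "pair_wf_digraph G" "pair_wf_digraph H"
    and X: "total_mutual_visibility_set (G \<box> H) X" and h: "h \<in> pverts H"
  shows "total_mutual_visibility_set G {g. (g, h) \<in> X}"
proof -
  have "visible G {g. (g, h) \<in> X} x y" if xy: "x \<in> pverts G" "y \<in> pverts G" for x y
  proof -
    obtain p where p: "shortest_path (G \<box> H) (x, h) p (y, h)"
      and avoid: "set (pawalk_verts (x, h) p) \<inter> X \<subseteq> {(x, h), (y, h)}"
      using total_mutual_visibility_set_shortest_path[OF X, of "(x, h)" "(y, h)"] h xy by auto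
    then have walk: "pwalk (G \<box> H) (x, h) p (y, h)"
      and min: "\<And>q. pwalk (G \<box> H) (x, h) q (y, h) \<Longrightarrow> length p \<le> length q"
      by (auto simp: shortest_path_iff[OF pair_wf_digraph_cartesian_product[OF wf]])
    obtain q r where q: "pwalk G x q y" and r: "pwalk H h r h" and len: "length p = length q + length r"
      and sub: "set (pawalk_verts (x, h) p) \<subseteq> set (pawalk_verts x q) \<times> set (pawalk_verts h r)"
        "set (pawalk_verts x q) \<subseteq> fst ` set (pawalk_verts (x, h) p)"
      using pwalk_product_project[OF wf walk] by blast
    have min': "length p \<le> length q'" if "pwalk G x q' y" for q'
      using min[OF pwalk_layer_left[OF wf(1) that h]] by simp
    \<comment> \<open>The lift of \<open>q\<close> to the layer competes with \<open>p\<close>, so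
      \<open>length q + length r\<close> is at most \<open>length q\<close>.\<close>
    have "r = []"
      using min'[OF q] len by simp
    \<comment> \<open>Every vertex of \<open>q\<close> is the first coordinate of a vertex of
      \<open>p\<close>, whose second coordinate is \<open>h\<close> because \<open>r\<close> is
      empty.\<close>
    then have "(v, h) \<in> set (pawalk_verts (x, h) p)" if "v \<in> set (pawalk_verts x q)" for v
      using sub that by fastforce
    then have "set (pawalk_verts x q) \<inter> {g. (g, h) \<in> X} \<subseteq> {x, y}"
      using avoid by blast
    moreover have "shortest_path G x q y"
      using q min' len \<open>r = []\<close> by (simp add: shortest_path_iff[OF wf(1)])
    ultimately show ?thesis
      by (auto simp: visible_def)
  qed
  then show ?thesis
    using X by (auto simp: total_mutual_visibility_set_def)
qed

(* When both endpoints of a shortest path lie in the independent set T, the path is not a single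
   edge, so its second vertex is an interior one. *)
lemma shortest_path_split_outside:
  assumes wf: "pair_wf_digraph H" and T: "independent_set H T"
    and Q: "shortest_path H h Q h'" and avoid: "set (pawalk_verts h Q) \<inter> T \<subseteq> {h, h'}" and "h \<noteq> h'"
  obtains Q1 Q2 k where "Q = Q1 @ Q2" "pwalk H h Q1 k" "pwalk H k Q2 h'" "k \<notin> T"
proof -
  interpret H: pair_wf_digraph H by fact
  have apath: "H.apath h Q h'" and walk: "H.awalk h Q h'"
    using Q by (auto simp: shortest_path_def H.apath_def)
  consider "h \<notin> T" | "h' \<notin> T" | "h \<in> T" "h' \<in> T" by blast
  then show thesis
  proof cases
    \<comment> \<open>An endpoint of \<open>Q\<close> outside \<open>T\<close> serves as
      \<open>k\<close>, with one of the two pieces empty.\<close>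
    case 1
    then show ?thesis
      using that[of "[]" Q h] walk H.awalk_hd_in_verts[OF walk] by (auto simp: H.awalk_Nil_iff)
  next
    case 2
    then show ?thesis
      using that[of Q "[]" h'] walk H.awalk_last_in_verts[OF walk] by (auto simp: H.awalk_Nil_iff)
  next
    case 3
    obtain e Q' where Q': "Q = e # Q'"
      using \<open>h \<noteq> h'\<close> walk by (cases Q) (auto simp: H.awalk_Nil_iff)
    then have e: "e \<in> parcs H" "fst e = h" "H.apath (snd e) Q' h'" "h \<notin> set (pawalk_verts (snd e) Q')"
      using apath by (auto simp: H.apath_Cons_iff)
    have "Q' \<noteq> []"
    proof
      assume "Q' = []"
      then have "e = (h, h')"
        using e by (cases e) (auto simp: H.apath_Nil_iff)
      then show False
        using T 3 e(1) by (auto simp: independent_set_def)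
    qed
    then have "snd e \<noteq> h'"
      using e(3) H.apath_nonempty_ends by blast
    moreover have "snd e \<in> set (pawalk_verts (snd e) Q')"
      using e(3) H.hd_in_awalk_verts(2) by blast
    ultimately have "snd e \<notin> T"
      using avoid e(4) Q' by auto
    moreover have "H.awalk h [e] (snd e)"
      using H.arc_implies_awalk[of e] e by auto
    ultimately show ?thesis
      using that[of "[e]" Q' "snd e"] Q' e(3) by (auto simp: H.apath_def)
  qed
qed

text \<open>For \<open>h \<noteq> h'\<close> the layer over \<open>k\<close> misses
  \<open>S \<times> T\<close>, so \<open>P\<close> is crossed there freely. The pieces over
  \<open>g\<close> and \<open>g'\<close> can meet \<open>S \<times> T\<close> only where
  \<open>Q\<close> meets \<open>T\<close>, that is, over \<open>h\<close> and
  \<open>h'\<close>.\<close>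

lemma total_mutual_visibility_set_Times:
  assumes wf: "pair_wf_digraph G" "pair_wf_digraph H"
    and S: "total_mutual_visibility_set G S"
    and T: "total_mutual_visibility_set H T" "independent_set H T"
  shows "total_mutual_visibility_set (G \<box> H) (S \<times> T)"
proof -
  interpret G: pair_wf_digraph G by fact
  interpret H: pair_wf_digraph H by fact
  note wfGH = pair_wf_digraph_cartesian_product[OF wf]
  interpret GH: pair_wf_digraph "G \<box> H" by (rule wfGH)
  have "visible (G \<box> H) (S \<times> T) (g, h) (g', h')"
    if gh: "g \<in> pverts G" "h \<in> pverts H" "g' \<in> pverts G" "h' \<in> pverts H" for g h g' h'
  proof -
    obtain P where P: "shortest_path G g P g'" and avP: "set (pawalk_verts g P) \<inter> S \<subseteq> {g, g'}"
      using total_mutual_visibility_set_shortest_path[OF S] gh by blast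
    obtain Q where Q: "shortest_path H h Q h'" and avQ: "set (pawalk_verts h Q) \<inter> T \<subseteq> {h, h'}"
      using total_mutual_visibility_set_shortest_path[OF T(1)] gh by blast
    have wP: "G.awalk g P g'" and minP: "\<And>q. G.awalk g q g' \<Longrightarrow> length P \<le> length q"
      using P by (auto simp: shortest_path_iff[OF wf(1)])
    have wQ: "H.awalk h Q h'" and minQ: "\<And>q. H.awalk h q h' \<Longrightarrow> length Q \<le> length q"
      using Q by (auto simp: shortest_path_iff[OF wf(2)])
    \<comment> \<open>By projection every walk between these vertices has length at least
      \<open>length P + length Q\<close>, so a walk within that bound is a shortest path.\<close>
    have shortest: "shortest_path (G \<box> H) (g, h) p (g', h')"
      if p: "GH.awalk (g, h) p (g', h')" "length p \<le> length P + length Q" for p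
    proof -
      have "length p \<le> length q" if q: "GH.awalk (g, h) q (g', h')" for q
      proof -
        obtain r s where "G.awalk g r g'" "H.awalk h s h'" "length q = length r + length s"
          using pwalk_product_project[OF wf q] .
        then show ?thesis
          using minP[of r] minQ[of s] p(2) by linarith
      qed
      then show ?thesis
        using p(1) by (simp add: shortest_path_iff[OF wfGH])
    qed
    define layer where "layer k = map (map_prod (\<lambda>a. (a, k)) (\<lambda>a. (a, k))) P" for k :: 'b
    have layer: "GH.awalk (g, k) (layer k) (g', k)"
        "set (pawalk_verts (g, k) (layer k)) = set (pawalk_verts g P) \<times> {k}"
        "length (layer k) = length P" if "k \<in> pverts H" for k
      using pwalk_layer_left[OF wf(1) wP that] pawalk_verts_map[of "\<lambda>a. (a, k)" g P]
      by (auto simp: layer_def)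
    show ?thesis
    proof (cases "h = h'")
      case True
      \<comment> \<open>Here \<open>P\<close> is copied into the layer over \<open>h\<close>, where
        it meets \<open>S \<times> T\<close> only where \<open>P\<close> meets
        \<open>S\<close>.\<close>
      have "set (pawalk_verts (g, h) (layer h)) \<inter> S \<times> T \<subseteq> {(g, h), (g', h')}"
        unfolding layer(2)[OF gh(2)] using avP True by blast
      moreover have "shortest_path (G \<box> H) (g, h) (layer h) (g', h')"
        using layer(1,3)[OF gh(2)] True by (intro shortest) simp_all
      ultimately show ?thesis
        unfolding visible_def by blast
    next
      case False
      obtain Q1 Q2 k where split: "Q = Q1 @ Q2" "H.awalk h Q1 k" "H.awalk k Q2 h'" "k \<notin> T"
        using shortest_path_split_outside[OF wf(2) T(2) Q avQ False] by blast
      have k: "k \<in> pverts H"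
        using H.awalk_last_in_verts[OF split(2)] by simp
      have vQ: "set (pawalk_verts h Q) = set (pawalk_verts h Q1) \<union> set (pawalk_verts k Q2)"
        using H.set_awalk_verts_append[OF split(2,3)] split(1) by simp
      have "H.apath h (Q1 @ Q2) h'"
        using Q split(1) by (simp add: shortest_path_def)
      then have disj: "set (pawalk_verts h Q1) \<inter> set (tl (pawalk_verts k Q2)) = {}"
        using split(2) by (simp add: H.apath_append_iff)
      obtain vs where vs: "pawalk_verts k Q2 = k # vs"
        using H.awhd_of_awalk[OF split(3)] by (cases Q2) simp_all
      \<comment> \<open>\<open>Q\<close> repeats no vertex, so \<open>Q1\<close> and the tail
        \<open>vs\<close> of the vertex list of \<open>Q2\<close> are disjoint; only the head
        \<open>k\<close> is shared.\<close>
      have meet: "v = k" if "v \<in> set (pawalk_verts h Q1)" "v \<in> set (pawalk_verts k Q2)" for v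
        using that disj unfolding vs by auto
      note ends = pwalk_ends_in_verts(1)[OF split(2)] pwalk_ends_in_verts(2)[OF split(3)]
      let ?L = "\<lambda>a w. map (map_prod (Pair a) (Pair a)) w"
      \<comment> \<open>\<open>Q1\<close> is followed over \<open>g\<close>, then \<open>P\<close>
        over \<open>k\<close>, then \<open>Q2\<close> over \<open>g'\<close>; the length is exactly
        the bound in \<open>shortest\<close>.\<close>
      let ?p = "?L g Q1 @ layer k @ ?L g' Q2"
      note w1 = pwalk_layer_right[OF wf(2) split(2) gh(1)]
        and w2 = pwalk_layer_right[OF wf(2) split(3) gh(3)]
      note w3 = GH.awalk_appendI[OF layer(1)[OF k] w2]
      have verts: "set (pawalk_verts (g, h) ?p) =
          {g} \<times> set (pawalk_verts h Q1) \<union> set (pawalk_verts g P) \<times> {k} \<union> {g'} \<times> set (pawalk_verts k Q2)"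
        unfolding GH.set_awalk_verts_append[OF w1 w3] GH.set_awalk_verts_append[OF layer(1)[OF k] w2]
          layer(2)[OF k] pawalk_verts_map set_map by blast
      \<comment> \<open>It is not enough that \<open>v\<close> is \<open>h\<close> or
        \<open>h'\<close>: \<open>(g, h')\<close> and \<open>(g', h)\<close> must be avoided as
        well. If \<open>h'\<close> were on \<open>Q1\<close>, it would be shared with
        \<open>Q2\<close>, hence equal to \<open>k\<close>, which is outside \<open>T\<close>. The
        argument for \<open>h\<close> on \<open>Q2\<close> is symmetric.\<close>
      have "v = h" if "v \<in> set (pawalk_verts h Q1)" "v \<in> T" for v
        using that avQ vQ meet ends split(4) by blast
      moreover have "v = h'" if "v \<in> set (pawalk_verts k Q2)" "v \<in> T" for v
        using that avQ vQ meet ends split(4) by blast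
      ultimately have "set (pawalk_verts (g, h) ?p) \<inter> S \<times> T \<subseteq> {(g, h), (g', h')}"
        using split(4) unfolding verts by blast
      moreover have "shortest_path (G \<box> H) (g, h) ?p (g', h')"
        using GH.awalk_appendI[OF w1 w3] split(1) layer(3)[OF k] by (intro shortest) simp_all
      ultimately show ?thesis
        unfolding visible_def by blast
    qed
  qed
  then show ?thesis
    using S T by (auto simp: total_mutual_visibility_set_def)
qed

text \<open>Exchanging coordinates is an isomorphism. It lets each bound be proved for one order of
  the factors only.\<close>

lemma total_mutual_visibility_set_swap:
  assumes wf: "pair_wf_digraph G" "pair_wf_digraph H"
    and X: "total_mutual_visibility_set (G \<box> H) X"
  shows "total_mutual_visibility_set (H \<box> G) (prod.swap ` X)"
proof -
  \<comment> \<open>The factors are arbitrary because both directions occur: the path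
    \<open>p\<close> is sent to \<open>H \<box> G\<close>, and competing walks are sent back to
    \<open>G \<box> H\<close>.\<close>
  have swap_walk: "pwalk (L \<box> K) (prod.swap x) (map (map_prod prod.swap prod.swap) p) (prod.swap y)"
    if "pwalk (K \<box> L) x p y" for x y p and K :: "'c pair_pre_digraph" and L :: "'d pair_pre_digraph"
    by (rule pwalk_map[OF that]) (auto simp: parcs_cartesian_product_iff)
  have "visible (H \<box> G) (prod.swap ` X) (prod.swap x) (prod.swap y)"
    if xy: "x \<in> pverts (G \<box> H)" "y \<in> pverts (G \<box> H)" for x y
  proof -
    obtain p where p: "shortest_path (G \<box> H) x p y" "set (pawalk_verts x p) \<inter> X \<subseteq> {x, y}"
      using total_mutual_visibility_set_shortest_path[OF X xy] .
    let ?p = "map (map_prod prod.swap prod.swap) p"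
    have "length p \<le> length q" if "pwalk (H \<box> G) (prod.swap x) q (prod.swap y)" for q
      using swap_walk[OF that] p(1)
      by (force simp: shortest_path_iff pair_wf_digraph_cartesian_product wf)
    then have "shortest_path (H \<box> G) (prod.swap x) ?p (prod.swap y)"
      using swap_walk[of G H x p y] p(1)
      by (simp add: shortest_path_iff pair_wf_digraph_cartesian_product wf)
    moreover have "set (pawalk_verts (prod.swap x) ?p) \<inter> prod.swap ` X \<subseteq> {prod.swap x, prod.swap y}"
      using p(2) by (auto simp: pawalk_verts_map)
    ultimately show ?thesis
      unfolding visible_def by blast
  qed
  then show ?thesis
    using X by (fastforce simp: total_mutual_visibility_set_def)
qed

section \<open>Cardinalities and the two bounds\<close>

lemma card_le_mu_t:
  assumes "finite (pverts G)" "total_mutual_visibility_set G X"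
  shows "card X \<le> mu_t G"
  unfolding mu_t_def
  using assms finite_total_mutual_visibility_sets by (intro Max_ge finite_image_set) auto

text \<open>The set \<open>X\<close> witnesses that the maximum is taken over a nonempty
  set.\<close>

lemma mu_t_attained:
  assumes "finite (pverts G)" "total_mutual_visibility_set G X"
  obtains Y where "total_mutual_visibility_set G Y" "card Y = mu_t G"
proof -
  have "mu_t G \<in> {card X | X. total_mutual_visibility_set G X}"
    unfolding mu_t_def
    using assms finite_total_mutual_visibility_sets by (intro Max_in finite_image_set) auto
  then show thesis
    using that by auto
qed

lemma mu_it_attained:
  assumes "finite (pverts G)" "total_mutual_visibility_set G X" "independent_set G X"
  obtains Y where "total_mutual_visibility_set G Y" "independent_set G Y" "card Y = mu_it G"
proof -
  have "finite {X. total_mutual_visibility_set G X \<and> independent_set G X}"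
    using finite_total_mutual_visibility_sets[OF assms(1)] by (rule rev_finite_subset) auto
  then have "mu_it G \<in> {card X | X. total_mutual_visibility_set G X \<and> independent_set G X}"
    unfolding mu_it_def using assms by (intro Max_in finite_image_set) auto
  then show thesis
    using that by auto
qed

text \<open>The required witness in the product is \<open>{} \<times> {}\<close>, a product of total
  mutual-visibility sets of the factors.\<close>

lemma mu_t_cartesian_product_attained:
  assumes "pair_graph G" "connected (with_proj G)" "pair_graph H" "connected (with_proj H)"
  obtains X where "total_mutual_visibility_set (G \<box> H) X" "card X = mu_t (G \<box> H)"
proof -
  interpret G: pair_graph G by fact
  interpret H: pair_graph H by fact
  have "finite (pverts (G \<box> H))"
    by (simp add: G.pair_finite_verts H.pair_finite_verts)
  then show thesis
    using mu_t_attained that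
      total_mutual_visibility_set_Times[OF G.pair_wf_digraph H.pair_wf_digraph
        total_mutual_visibility_set_empty[OF assms(1,2)]
        total_mutual_visibility_set_empty[OF assms(3,4)] independent_set_empty]
    by blast
qed

text \<open>Swapping preserves cardinality. Applied in both orders, the inequality becomes an
  equality.\<close>

lemma mu_t_cartesian_product_commute_le:
  assumes "pair_graph G" "connected (with_proj G)" "pair_graph H" "connected (with_proj H)"
  shows "mu_t (G \<box> H) \<le> mu_t (H \<box> G)"
proof -
  interpret G: pair_graph G by fact
  interpret H: pair_graph H by fact
  have wf: "pair_wf_digraph G" "pair_wf_digraph H"
    by (rule G.pair_wf_digraph H.pair_wf_digraph)+
  obtain X where X: "total_mutual_visibility_set (G \<box> H) X" "card X = mu_t (G \<box> H)"
    using mu_t_cartesian_product_attained[OF assms] .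
  then show ?thesis
    using card_le_mu_t[OF _ total_mutual_visibility_set_swap[OF wf X(1)]]
    by (simp add: G.pair_finite_verts H.pair_finite_verts card_image inj_swap)
qed

text \<open>A largest set of \<open>G\<close> is multiplied by a largest independent one of
  \<open>H\<close>.\<close>

lemma mu_it_mult_mu_t_le:
  assumes "pair_graph G" "connected (with_proj G)" "pair_graph H" "connected (with_proj H)"
  shows "mu_it H * mu_t G \<le> mu_t (G \<box> H)"
proof -
  interpret G: pair_graph G by fact
  interpret H: pair_graph H by fact
  have wf: "pair_wf_digraph G" "pair_wf_digraph H"
    by (rule G.pair_wf_digraph H.pair_wf_digraph)+
  obtain S where S: "total_mutual_visibility_set G S" "card S = mu_t G"
    using mu_t_attained[OF G.pair_finite_verts total_mutual_visibility_set_empty[OF assms(1,2)]] .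
  obtain T where T: "total_mutual_visibility_set H T" "independent_set H T" "card T = mu_it H"
    using mu_it_attained[OF H.pair_finite_verts total_mutual_visibility_set_empty[OF assms(3,4)]
        independent_set_empty] .
  show ?thesis
    using card_le_mu_t[OF _ total_mutual_visibility_set_Times[OF wf S(1) T(1,2)]] S(2) T(3)
    by (simp add: G.pair_finite_verts H.pair_finite_verts card_cartesian_product mult.commute)
qed

text \<open>A largest set of the product is cut into its fibres over the vertices of
  \<open>H\<close>, each of size at most \<open>mu_t G\<close>.\<close>

lemma mu_t_le_mu_t_mult_card:
  assumes "pair_graph G" "connected (with_proj G)" "pair_graph H" "connected (with_proj H)"
  shows "mu_t (G \<box> H) \<le> mu_t G * card (pverts H)"
proof -
  interpret G: pair_graph G by fact
  interpret H: pair_graph H by fact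
  have wf: "pair_wf_digraph G" "pair_wf_digraph H"
    by (rule G.pair_wf_digraph H.pair_wf_digraph)+
  obtain X where X: "total_mutual_visibility_set (G \<box> H) X" "card X = mu_t (G \<box> H)"
    using mu_t_cartesian_product_attained[OF assms] .
  have sub: "X \<subseteq> pverts G \<times> pverts H"
    using X(1) by (simp add: total_mutual_visibility_set_def)
  then have fin: "finite {g. (g, h) \<in> X}" for h
    by (intro finite_subset[OF _ G.pair_finite_verts]) auto
  \<comment> \<open>With the coordinate from \<open>H\<close> first, the set is a
    \<open>Sigma\<close> over \<open>H\<close>, whose cardinality is the sum of the fibre
    sizes.\<close>
  have "prod.swap ` X = Sigma (pverts H) (\<lambda>h. {g. (g, h) \<in> X})"
    using sub by force
  then have "card X = (\<Sum>h\<in>pverts H. card {g. (g, h) \<in> X})"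
    using card_SigmaI[OF H.pair_finite_verts, of "\<lambda>h. {g. (g, h) \<in> X}"] fin
      card_image[of prod.swap X] by simp
  also have "\<dots> \<le> (\<Sum>h\<in>pverts H. mu_t G)"
    using card_le_mu_t[OF G.pair_finite_verts] total_mutual_visibility_set_fibre[OF wf X(1)]
    by (intro sum_mono) auto
  finally show ?thesis
    using X(2) by (simp add: mult.commute)
qed

theorem theorem4p1:
  fixes G :: "'a pair_pre_digraph" and H :: "'b pair_pre_digraph"
  assumes "pair_graph G" and "connected (with_proj G)" and "card (pverts G) \<ge> 2"
    and "pair_graph H" and "connected (with_proj H)" and "card (pverts H) \<ge> 2"
    and "mu_it G \<ge> 1" and "mu_it H \<ge> 1"
  shows "max (mu_it H * mu_t G) (mu_it G * mu_t H) \<le> mu_t (G \<box> H) \<and>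
    mu_t (G \<box> H) \<le> min (mu_t G * card (pverts H)) (mu_t H * card (pverts G))"
proof -
  note GH = assms(1,2,4,5) and HG = assms(4,5,1,2)
  \<comment> \<open>This turns the bounds with \<open>G\<close> and \<open>H\<close> exchanged into
    bounds on the same number.\<close>
  have "mu_t (G \<box> H) = mu_t (H \<box> G)"
    using mu_t_cartesian_product_commute_le[OF GH] mu_t_cartesian_product_commute_le[OF HG]
    by (rule order_antisym)
  then show ?thesis
    using mu_it_mult_mu_t_le[OF GH] mu_it_mult_mu_t_le[OF HG]
      mu_t_le_mu_t_mult_card[OF GH] mu_t_le_mu_t_mult_card[OF HG] by simp
qed

end
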